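(* For every $j\in\mathbb{Z}_+$ let $\rho_j$ be a positive integer and let $\psi^m_j\in L_2$, $m=1,\dots,\rho_j$. The family $\{S^k_j\psi^m_j : j\in\mathbb{Z}_+,\ m=1,\dots,\rho_j,\ k\in\mathcal{R}_j\}$ forms a Parseval wavelet frame in $L_2$ if and only if both of the following hold: $$\sum_{j=0}^{\infty}\sum_{m=1}^{\rho_j}2^j\left|\widehat{\psi^m_j}(n)\right|^2=1\quad\text{for all } n\in\mathbb{Z},$$ $$\sum_{q=0}^{j}2^{q}\sum_{m=1}^{\rho_q}\overline{\widehat{\psi^m_q}(n)}\,\widehat{\psi^m_q}(2^jk+n)=0\quad\text{for all odd integers } k,\ \text{all } n\in\mathbb{Z},\ \text{all } j\in\mathbb{Z}_+.$$
   Context: $\mathbb{Z}_+$ is the set of non-negative integers. $L_2$ is the space of 1-periodic complex-valued square-integrable functions with $\langle f,g\rangle=\int_0^1 f(x)\overline{g(x)}\,dx$ and $\|f\|_2=\langle f,f\rangle^{1/2}$. Fourier coefficients are $\widehat f(n)=\langle f,e^{2\pi i n\cdot}\rangle$, $n\in\mathbb{Z}$. The shift operator is $S^k_jf=f(\cdot+2^{-j}k)$. The index set is $\mathcal{R}_j=\{-2^{j-1}+1,-2^{j-1}+2,\dots,2^{j-1}\}$ for $j\ge1$ and $\mathcal{R}_0=\{0\}$ (a complete set of residues modulo $2^j$). The family $\{S^k_j\psi^m_j\}$ forms a Parseval wavelet frame in $L_2$ if $$\|f\|_2^2=\sum_{j=0}^{\infty}\sum_{m=1}^{\rho_j}\sum_{k\in\mathcal{R}_j}|\langle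 f,S^k_j\psi^m_j\rangle|^2\quad\text{for all } f\in L_2 .$$ *)

theory Defs
  imports "HOL-Analysis.Analysis"
begin

text \<open>
  Elements of \<open>L\<^sub>2\<close> are represented by functions on the real line that are 1-periodic everywhere,
  Lebesgue measurable and square integrable over a period; functions that agree almost everywhere
  are not identified.
\<close>

definition periodic_L2 :: "(real \<Rightarrow> complex) set" where
  "periodic_L2 = {f. f \<in> borel_measurable lebesgue \<and> (\<forall>x. f (x + 1) = f x) \<and>
                     set_integrable lebesgue {0..1} (\<lambda>x. (cmod (f x))\<^sup>2)}"

definition L2_inner :: "(real \<Rightarrow> complex) \<Rightarrow> (real \<Rightarrow> complex) \<Rightarrow> complex" where
  "L2_inner f g = (LINT x:{0..1}|lebesgue. f x * cnj (g x))"

text \<open>\<open>L2_inner f f\<close> is real, so taking the real part below loses nothing.\<close>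

definition L2_norm :: "(real \<Rightarrow> complex) \<Rightarrow> real" where
  "L2_norm f = sqrt (Re (L2_inner f f))"

definition fourier_coeff :: "(real \<Rightarrow> complex) \<Rightarrow> int \<Rightarrow> complex" where
  "fourier_coeff f n = L2_inner f (\<lambda>x. exp (2 * of_real pi * \<i> * of_int n * of_real x))"

definition dyadic_shift :: "nat \<Rightarrow> int \<Rightarrow> (real \<Rightarrow> complex) \<Rightarrow> real \<Rightarrow> complex" where
  "dyadic_shift j k f = (\<lambda>x. f (x + of_int k / 2 ^ j))"

definition dyadic_residues :: "nat \<Rightarrow> int set" where
  "dyadic_residues j = (if j = 0 then {0} else {- (2 ^ (j - 1)) + 1 .. 2 ^ (j - 1)})"

text \<open>
  The generators at level \<open>j\<close> are \<open>\<psi> j 1, \<dots>, \<psi> j (\<rho> j)\<close>. The series over \<open>j\<close> has non-negative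
  terms; convergence is part of the condition.
\<close>

definition parseval_wavelet_frame ::
  "(nat \<Rightarrow> nat) \<Rightarrow> (nat \<Rightarrow> nat \<Rightarrow> real \<Rightarrow> complex) \<Rightarrow> bool" where
  "parseval_wavelet_frame \<rho> \<psi> \<longleftrightarrow>
     (\<forall>f\<in>periodic_L2.
        (\<lambda>j. \<Sum>m=1..\<rho> j. \<Sum>k\<in>dyadic_residues j.
               (cmod (L2_inner f (dyadic_shift j k (\<psi> j m))))\<^sup>2) sums (L2_norm f)\<^sup>2)"

end

theory Submission
  imports Defs
begin

text \<open>
  For a trigonometric polynomial \<open>f\<close> with coefficients \<open>c n\<close>, summing over the shifts
  \<open>k \<in> R\<^sub>j\<close> keeps exactly the pairs of frequencies that agree modulo \<open>2 ^ j\<close>, so the energy of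
  level \<open>j\<close> is a Hermitian form in \<open>c\<close> whose entry at \<open>(n, l)\<close> vanishes unless \<open>2 ^ j\<close> divides
  \<open>l - n\<close>. For \<open>l - n = 2 ^ v * k\<close> with \<open>k\<close> odd only the levels \<open>j \<le> v\<close> contribute. The two
  conditions of the theorem therefore say that the entries sum over all levels to the identity
  matrix, which is the Parseval identity for trigonometric polynomials; testing it on one and on
  two frequencies recovers the entries. The square root of a partial sum of the energy is a
  seminorm bounded by the norm on trigonometric polynomials, so by density and continuity it is
  bounded by the norm on all of \<open>L\<^sub>2\<close>, and the Parseval identity extends.
\<close>

subsection \<open>Square integrable functions\<close>

lemma borel_measurable_cnj [measurable]: "cnj \<in> borel_measurable borel"
  by (intro borel_measurable_continuous_onI continuous_intros)

text \<open>A general measure keeps Cauchy-Schwarz and Minkowski free of set integrals. The instance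
  used below is \<open>lebesgue_on {0..1}\<close>.\<close>

definition square_integrable :: "'a measure \<Rightarrow> ('a \<Rightarrow> complex) \<Rightarrow> bool" where
  "square_integrable M f \<longleftrightarrow> f \<in> borel_measurable M \<and> integrable M (\<lambda>x. (cmod (f x))\<^sup>2)"

lemma square_integrable_mult_cnj:
  assumes "square_integrable M f" "square_integrable M g"
  shows "integrable M (\<lambda>x. f x * cnj (g x))"
proof (rule Bochner_Integration.integrable_bound)
  show "integrable M (\<lambda>x. (cmod (f x))\<^sup>2 + (cmod (g x))\<^sup>2)"
    using assms by (simp add: square_integrable_def)
  have [measurable]: "f \<in> borel_measurable M" "g \<in> borel_measurable M"
    using assms by (auto simp: square_integrable_def)
  show "(\<lambda>x. f x * cnj (g x)) \<in> borel_measurable M" by measurable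
  have "cmod a * cmod b \<le> (cmod a)\<^sup>2 + (cmod b)\<^sup>2" for a b
    using sum_squares_bound[of "cmod a" "cmod b"] mult_nonneg_nonneg[OF norm_ge_zero norm_ge_zero, of a b] by linarith
  then show "AE x in M. norm (f x * cnj (g x)) \<le> norm ((cmod (f x))\<^sup>2 + (cmod (g x))\<^sup>2)"
    by (simp add: norm_mult)
qed

lemma square_integrable_scale:
  "square_integrable M f \<Longrightarrow> square_integrable M (\<lambda>x. c * f x)"
  by (auto simp: square_integrable_def norm_mult power_mult_distrib)

lemma square_integrable_add:
  assumes "square_integrable M f" "square_integrable M g"
  shows "square_integrable M (\<lambda>x. f x + g x)"
  unfolding square_integrable_def
proof
  have [measurable]: "f \<in> borel_measurable M" "g \<in> borel_measurable M"
    using assms by (auto simp: square_integrable_def)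
  show "(\<lambda>x. f x + g x) \<in> borel_measurable M" by measurable
  show "integrable M (\<lambda>x. (cmod (f x + g x))\<^sup>2)"
  proof (rule Bochner_Integration.integrable_bound)
    show "integrable M (\<lambda>x. 2 * (cmod (f x))\<^sup>2 + 2 * (cmod (g x))\<^sup>2)"
      using assms by (simp add: square_integrable_def)
    have "(cmod (a + b))\<^sup>2 \<le> 2 * (cmod a)\<^sup>2 + 2 * (cmod b)\<^sup>2" for a b
    proof -
      have "(cmod (a + b))\<^sup>2 \<le> (cmod a + cmod b)\<^sup>2"
        by (intro power_mono norm_triangle_ineq) auto
      also have "\<dots> \<le> 2 * (cmod a)\<^sup>2 + 2 * (cmod b)\<^sup>2"
        using sum_squares_bound[of "cmod a" "cmod b"] by (simp add: power2_sum)
      finally show ?thesis .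
    qed
    then show "AE x in M. norm ((cmod (f x + g x))\<^sup>2) \<le> norm (2 * (cmod (f x))\<^sup>2 + 2 * (cmod (g x))\<^sup>2)"
      by simp
  qed measurable
qed

lemma square_integrable_diff:
  "square_integrable M f \<Longrightarrow> square_integrable M g \<Longrightarrow> square_integrable M (\<lambda>x. f x - g x)"
  using square_integrable_add[OF _ square_integrable_scale[of M g "-1"], of f] by simp

lemma square_integrable_sum:
  "(\<And>i. i \<in> A \<Longrightarrow> square_integrable M (f i)) \<Longrightarrow> square_integrable M (\<lambda>x. \<Sum>i\<in>A. f i x)"
proof (induction A rule: infinite_finite_induct)
  case (insert i A)
  then show ?case by (simp add: square_integrable_add)
qed (simp_all add: square_integrable_def)

lemma square_integrable_bounded:
  assumes "finite_measure M" "f \<in> borel_measurable M" "\<And>x. x \<in> space M \<Longrightarrow> cmod (f x) \<le> C"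
  shows "square_integrable M f"
  unfolding square_integrable_def
proof
  have [measurable]: "f \<in> borel_measurable M" by fact
  show "f \<in> borel_measurable M" by fact
  interpret finite_measure M by fact
  show "integrable M (\<lambda>x. (cmod (f x))\<^sup>2)"
    by (rule integrable_const_bound[where B="C\<^sup>2"]) (auto intro!: AE_I2 power_mono assms(3))
qed

text \<open>The integral of the square of \<open>cmod (f x) + t * cmod (g x)\<close> is a quadratic
  in \<open>t\<close> that is never negative. Taking moduli first keeps it real and bounds the
  larger integral \<open>?I\<close>.\<close>

lemma Cauchy_Schwarz_integral:
  assumes f: "square_integrable M f" and g: "square_integrable M g"
  shows "cmod (LINT x|M. f x * cnj (g x))
    \<le> sqrt (LINT x|M. (cmod (f x))\<^sup>2) * sqrt (LINT x|M. (cmod (g x))\<^sup>2)"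
proof -
  let ?F = "LINT x|M. (cmod (f x))\<^sup>2" and ?G = "LINT x|M. (cmod (g x))\<^sup>2"
  let ?I = "LINT x|M. cmod (f x) * cmod (g x)"
  have [measurable]: "f \<in> borel_measurable M" "g \<in> borel_measurable M"
    using f g by (auto simp: square_integrable_def)
  have fi: "integrable M (\<lambda>x. (cmod (f x))\<^sup>2)" and gi: "integrable M (\<lambda>x. (cmod (g x))\<^sup>2)"
    using f g by (auto simp: square_integrable_def)
  have fg: "integrable M (\<lambda>x. cmod (f x) * cmod (g x))"
    using integrable_norm[OF square_integrable_mult_cnj[OF f g]] by (simp add: norm_mult)
  have quad: "0 \<le> ?F + 2 * t * ?I + t\<^sup>2 * ?G" for t
  proof -
    have "0 \<le> (LINT x|M. (cmod (f x) + t * cmod (g x))\<^sup>2)" by simp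
    also have "\<dots> = (LINT x|M. (cmod (f x))\<^sup>2 + 2 * t * (cmod (f x) * cmod (g x)) + t\<^sup>2 * (cmod (g x))\<^sup>2)"
      by (intro Bochner_Integration.integral_cong) (auto simp: power2_eq_square algebra_simps)
    also have "\<dots> = ?F + 2 * t * ?I + t\<^sup>2 * ?G"
      using fi gi fg by simp
    finally show ?thesis .
  qed
  have F0: "0 \<le> ?F" and G0: "0 \<le> ?G" and I0: "0 \<le> ?I" by auto
  have "?I\<^sup>2 \<le> ?F * ?G"
  proof (cases "?G = 0")
    case True
    have "?I = 0"
    proof (rule ccontr)
      assume "?I \<noteq> 0"
      then have "?I > 0" using I0 by linarith
      \<comment> \<open>With \<open>?G = 0\<close> the quadratic is affine in \<open>t\<close>, and
        this \<open>t\<close> gives it the value -1.\<close>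
      with quad[of "- (?F + 1) / (2 * ?I)"] True show False by (simp add: field_simps)
    qed
    then show ?thesis using True by simp
  next
    case False
    then have G: "?G > 0" using G0 by linarith
    \<comment> \<open>The value of the quadratic at its minimum,
      \<open>t = - ?I / ?G\<close>.\<close>
    have "0 \<le> ?F - ?I\<^sup>2 / ?G"
      using quad[of "- ?I / ?G"] G by (simp add: power2_eq_square field_simps)
    then show ?thesis using G by (simp add: field_simps)
  qed
  then have "?I \<le> sqrt ?F * sqrt ?G"
    by (metis real_le_rsqrt real_sqrt_mult)
  moreover have "cmod (LINT x|M. f x * cnj (g x)) \<le> ?I"
    using integral_norm_bound[of M "\<lambda>x. f x * cnj (g x)"] by (simp add: norm_mult)
  ultimately show ?thesis by linarith
qed

lemma Minkowski_integral:
  assumes f: "square_integrable M f" and g: "square_integrable M g"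
  shows "sqrt (LINT x|M. (cmod (f x + g x))\<^sup>2)
    \<le> sqrt (LINT x|M. (cmod (f x))\<^sup>2) + sqrt (LINT x|M. (cmod (g x))\<^sup>2)"
proof (rule real_le_lsqrt)
  let ?F = "LINT x|M. (cmod (f x))\<^sup>2" and ?G = "LINT x|M. (cmod (g x))\<^sup>2"
  have fi: "integrable M (\<lambda>x. (cmod (f x))\<^sup>2)" and gi: "integrable M (\<lambda>x. (cmod (g x))\<^sup>2)"
    using f g by (auto simp: square_integrable_def)
  have fg: "integrable M (\<lambda>x. f x * cnj (g x))"
    by (rule square_integrable_mult_cnj[OF f g])
  have pt: "(cmod (a + b))\<^sup>2 = (cmod a)\<^sup>2 + 2 * Re (a * cnj b) + (cmod b)\<^sup>2" for a b
    by (simp only: cmod_power2) (simp add: power2_eq_square algebra_simps)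
  have "(LINT x|M. (cmod (f x + g x))\<^sup>2) = ?F + 2 * Re (LINT x|M. f x * cnj (g x)) + ?G"
    proof -
    have "(LINT x|M. Re (f x * cnj (g x))) = Re (LINT x|M. f x * cnj (g x))"
      using fg by (rule integral_Re)
    moreover have "integrable M (\<lambda>x. Re (f x * cnj (g x)))"
      using fg by (rule integrable_Re)
    ultimately show ?thesis
      unfolding pt using fi gi by (simp del: times_complex.simps)
  qed
  also have "\<dots> \<le> ?F + 2 * (sqrt ?F * sqrt ?G) + ?G"
    using Cauchy_Schwarz_integral[OF f g] complex_Re_le_cmod[of "LINT x|M. f x * cnj (g x)"] by linarith
  also have "\<dots> = (sqrt ?F + sqrt ?G)\<^sup>2"
    by (simp add: power2_sum)
  finally show "(LINT x|M. (cmod (f x + g x))\<^sup>2) \<le> (sqrt ?F + sqrt ?G)\<^sup>2" .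
qed auto

section \<open>Inner product, norm and translation of periodic functions\<close>

lemma L2_inner_eq: "L2_inner f g = (LINT x|lebesgue_on {0..1}. f x * cnj (g x))"
  by (simp add: L2_inner_def set_lebesgue_integral_def integral_restrict_space)

lemma L2_norm_eq: "L2_norm f = sqrt (LINT x|lebesgue_on {0..1}. (cmod (f x))\<^sup>2)"
proof -
  have "L2_inner f f = (LINT x|lebesgue_on {0..1}. complex_of_real ((cmod (f x))\<^sup>2))"
    by (simp add: L2_inner_eq complex_norm_square del: of_real_power)
  also have "\<dots> = of_real (LINT x|lebesgue_on {0..1}. (cmod (f x))\<^sup>2)"
    by (rule integral_complex_of_real)
  finally show ?thesis by (simp add: L2_norm_def)
qed

lemma periodic_L2_square_integrable:
  "f \<in> periodic_L2 \<Longrightarrow> square_integrable (lebesgue_on {0..1}) f"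
  by (auto simp: periodic_L2_def square_integrable_def set_integrable_def integrable_restrict_space
        intro: measurable_restrict_space1)

lemma periodic_L2I:
  assumes "f \<in> borel_measurable lebesgue" "\<And>x. f (x + 1) = f x"
    "square_integrable (lebesgue_on {0..1}) f"
  shows "f \<in> periodic_L2"
  using assms
  by (auto simp: periodic_L2_def square_integrable_def set_integrable_def integrable_restrict_space)

lemma L2_inner_cnj: "L2_inner g f = cnj (L2_inner f g)"
proof -
  have "cnj (L2_inner f g) = (LINT x|lebesgue_on {0..1}. cnj (f x * cnj (g x)))"
    unfolding L2_inner_eq by (rule Bochner_Integration.integral_cnj[symmetric])
  then show ?thesis by (simp add: L2_inner_eq mult.commute)
qed

text \<open>By periodicity only \<open>s = frac t\<close> matters. The window
  \<open>{s..1+s}\<close> is cut at 1 and the piece beyond 1 is moved back by one period, which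
  completes \<open>{0..1}\<close>. Integrability on \<open>{0..2}\<close> is secured first, so that
  all these pieces are covered.\<close>

lemma periodic_integral_shift:
  fixes g :: "real \<Rightarrow> 'a::euclidean_space"
  assumes per: "\<And>x. g (x + 1) = g x" and int: "set_integrable lebesgue {0..1} g"
  shows "set_integrable lebesgue {0..1} (\<lambda>x. g (x + t))"
    and "(LINT x:{0..1}|lebesgue. g (x + t)) = (LINT x:{0..1}|lebesgue. g x)"
proof -
  define s where "s = frac t"
  have s: "0 \<le> s" "s < 1" by (auto simp: s_def frac_lt_1)
  have pern: "g (x + of_int n) = g x" for x n
  proof (induction n arbitrary: x rule: int_induct[where k=0])
    case base then show ?case by simp
  next
    case (step1 i)
    have "g (x + of_int (i + 1)) = g (x + of_int i + 1)" by (simp add: add.assoc)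
    then show ?case using step1 per by simp
  next
    case (step2 i)
    have "g (x + of_int (i - 1)) = g (x + of_int (i - 1) + 1)" using per by metis
    also have "\<dots> = g (x + of_int i)" by simp
    finally show ?case using step2 by simp
  qed
  have gs: "(\<lambda>x. g (x + t)) = g \<circ> ((+) s)"
  proof
    fix x
    have "g (x + t) = g (x + s + of_int \<lfloor>t\<rfloor>)" by (simp add: s_def frac_def)
    then show "g (x + t) = (g \<circ> ((+) s)) x" using pern by (simp add: add.commute)
  qed
  have shift: "set_integrable lebesgue {a..b} (\<lambda>x. g (x + c))"
    if "set_integrable lebesgue {a+c..b+c} g" for a b c
  proof -
    have "integrable lebesgue (\<lambda>x. indicat_real {a+c..b+c} (c + 1 * x) *\<^sub>R g (c + 1 * x))"
      using that unfolding set_integrable_def by (rule lebesgue_integrable_real_affine) simp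
    moreover have "indicat_real {a+c..b+c} (c + 1 * x) = indicat_real {a..b} x" for x
      by (auto simp: indicator_def)
    ultimately show ?thesis by (simp add: set_integrable_def add.commute)
  qed
  have "set_integrable lebesgue {1..2} (\<lambda>x. g (x + (-1)))"
    by (rule shift) (use int in simp)
  moreover have "g (x + (-1)) = g x" for x using pern[of x "-1"] by simp
  ultimately have int2: "set_integrable lebesgue {1..2} g" by simp
  have int02: "set_integrable lebesgue ({0..1} \<union> {1..2}) g"
    by (rule set_integrable_Un[OF int int2]) auto
  have sub: "g absolutely_integrable_on {a..b}" if "0 \<le> a" "b \<le> 2" for a b
    by (rule absolutely_integrable_on_subinterval[OF int02]) (use that in auto)
  have "set_integrable lebesgue {0..1} (\<lambda>x. g (x + s))"
    by (rule shift) (use s in \<open>auto intro!: sub\<close>)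
  then show *: "set_integrable lebesgue {0..1} (\<lambda>x. g (x + t))"
    unfolding gs by (simp add: o_def add.commute)
  have gint: "g integrable_on {a..b}" if "0 \<le> a" "b \<le> 2" for a b
    using set_lebesgue_integral_eq_integral(1)[OF sub[OF that]] .
  have "(LINT x:{0..1}|lebesgue. g (x + t)) = integral {0..1} (g \<circ> ((+) s))"
    unfolding gs[symmetric] by (rule set_lebesgue_integral_eq_integral(2)[OF *])
  also have "\<dots> = integral {0+s..1+s} g" by (rule integral_shift_Icc_real)
  also have "\<dots> = integral {s..1} g + integral {0+1..s+1} g"
    using s by (subst Henstock_Kurzweil_Integration.integral_combine[of _ 1, symmetric]) (auto simp: add.commute intro: gint)
  also have "integral {0+1..s+1} g = integral {0..s} (g \<circ> ((+) 1))"
    by (rule integral_shift_Icc_real[symmetric])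
  also have "g \<circ> ((+) 1) = g" using per by (auto simp: add.commute)
  also have "integral {s..1} g + integral {0..s} g = integral {0..1} g"
    using s by (subst Henstock_Kurzweil_Integration.integral_combine[of 0 s, symmetric]) (auto simp: add.commute intro: gint)
  also have "\<dots> = (LINT x:{0..1}|lebesgue. g x)"
    by (rule set_lebesgue_integral_eq_integral(2)[OF int, symmetric])
  finally show "(LINT x:{0..1}|lebesgue. g (x + t)) = (LINT x:{0..1}|lebesgue. g x)" .
qed

text \<open>Composition with a Borel map can destroy Lebesgue measurability; an affine map with
  nonzero slope preserves it.\<close>

lemma borel_measurable_lebesgue_shift:
  assumes "f \<in> borel_measurable (lebesgue :: real measure)"
  shows "(\<lambda>x. f (x + t)) \<in> borel_measurable lebesgue"
proof -
  have "(\<lambda>x::real. t + 1 * x) \<in> lebesgue \<rightarrow>\<^sub>M lebesgue"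
    using lebesgue_affine_measurable[where c="\<lambda>x::real. 1" and t=t] by simp
  from measurable_compose[OF this assms] show ?thesis by (simp add: add.commute)
qed

lemma periodic_L2_shift:
  assumes "f \<in> periodic_L2"
  shows "(\<lambda>x. f (x + t)) \<in> periodic_L2"
proof -
  have f: "f \<in> borel_measurable lebesgue" "\<And>x. f (x + 1) = f x"
    "set_integrable lebesgue {0..1} (\<lambda>x. (cmod (f x))\<^sup>2)"
    using assms by (auto simp: periodic_L2_def)
  have "f (x + 1 + t) = f (x + t)" for x
    using f(2)[of "x + t"] by (simp add: add_ac)
  then show ?thesis
    using f borel_measurable_lebesgue_shift[OF f(1)] periodic_integral_shift(1)[of "\<lambda>x. (cmod (f x))\<^sup>2"]
    by (simp add: periodic_L2_def)
qed

subsection \<open>Trigonometric polynomials\<close>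

text \<open>The exponential is written as in \<open>fourier_coeff\<close>, so that
  \<open>fourier_coeff_eq\<close> is mere unfolding; \<open>trig_cis\<close> is the form used for
  calculation.\<close>

definition trig :: "int \<Rightarrow> real \<Rightarrow> complex" where
  "trig n x = exp (2 * of_real pi * \<i> * of_int n * of_real x)"

lemma fourier_coeff_eq: "fourier_coeff f n = L2_inner f (trig n)"
  by (simp add: fourier_coeff_def trig_def[abs_def])

lemma trig_cis: "trig n x = cis (2 * pi * of_int n * x)"
  by (simp add: trig_def cis_conv_exp mult_ac)

lemma trig_0 [simp]: "trig 0 x = 1" "trig n 0 = 1"
  by (simp_all add: trig_cis)

lemma norm_trig [simp]: "cmod (trig n x) = 1"
  by (simp add: trig_cis)

lemma trig_add: "trig n (x + y) = trig n x * trig n y"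
  by (simp add: trig_cis cis_mult algebra_simps)

lemma trig_mult: "trig n x * trig m x = trig (n + m) x"
  by (simp add: trig_cis cis_mult algebra_simps)

lemma cnj_trig: "cnj (trig n x) = trig (- n) x"
  by (simp add: trig_cis cis_cnj)

lemma trig_of_int [simp]: "trig n (of_int k) = 1"
proof -
  have "cis (2 * pi * of_int (n * k)) = 1"
    by (rule cis_multiple_2pi) simp
  then show ?thesis by (simp add: trig_cis mult.assoc)
qed

lemma trig_periodic [simp]: "trig n (x + 1) = trig n x"
  using trig_of_int[of n 1] by (simp add: trig_add)

lemma continuous_trig: "continuous_on S (trig n)"
  unfolding trig_cis by (intro continuous_intros)

lemma finite_measure_lebesgue_on_unit: "finite_measure (lebesgue_on {0..1::real})"
  by (rule finite_measure_lebesgue_on) auto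

lemma periodic_L2_trig: "trig n \<in> periodic_L2"
proof (rule periodic_L2I)
  show "trig n \<in> borel_measurable lebesgue"
    using continuous_imp_measurable_on_sets_lebesgue[OF continuous_trig, of UNIV n] by simp
  then show "square_integrable (lebesgue_on {0..1}) (trig n)"
    by (intro square_integrable_bounded[where C=1] finite_measure_lebesgue_on_unit
        measurable_restrict_space1) auto
qed simp

lemma L2_inner_trig: "L2_inner (trig n) (trig m) = (if n = m then 1 else 0)"
proof -
  have *: "L2_inner (trig n) (trig m) = (LINT x:{0..1}|lebesgue. trig (n - m) x)"
    by (simp add: L2_inner_def cnj_trig trig_mult)
  show ?thesis
  proof (cases "n = m")
    case True
    then show ?thesis unfolding *
      by (simp add: set_lebesgue_integral_def)
  next
    case False
    \<comment> \<open>translation by half a period changes the sign of the integrand\<close>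
    define t where "t = 1 / (2 * real_of_int (n - m))"
    have "2 * pi * real_of_int (n - m) * t = pi" using False by (simp add: t_def field_simps)
    then have t: "trig (n - m) t = -1" unfolding trig_cis by (metis cis_pi)
    \<comment> \<open>Pairing with \<open>trig 0\<close>, the constant 1, turns integrability of
      products into integrability of a single exponential.\<close>
    have "set_integrable lebesgue {0..1} (trig (n - m))"
      using square_integrable_mult_cnj[OF periodic_L2_square_integrable periodic_L2_square_integrable,
          OF periodic_L2_trig periodic_L2_trig, of "n - m" 0]
      by (simp add: set_integrable_def integrable_restrict_space)
    then have "(LINT x:{0..1}|lebesgue. trig (n - m) (x + t)) = (LINT x:{0..1}|lebesgue. trig (n - m) x)"
      by (intro periodic_integral_shift(2)) auto
    then have "- 1 * (LINT x:{0..1}|lebesgue. trig (n - m) x) = (LINT x:{0..1}|lebesgue. trig (n - m) x)"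
      unfolding trig_add t mult.commute[of _ "- 1"] set_integral_mult_right .
    then have "(LINT x:{0..1}|lebesgue. trig (n - m) x) = 0"
      by (simp add: complex_eq_iff)
    then show ?thesis using False * by simp
  qed
qed

section \<open>The algebra of trigonometric polynomials\<close>

text \<open>The inductive form makes closure under products a plain induction;
  \<open>trig_polynomial_expansion\<close> recovers the coefficients.\<close>

inductive trig_polynomial :: "(real \<Rightarrow> complex) \<Rightarrow> bool" where
  monomial: "trig_polynomial (\<lambda>x. c * trig n x)"
| add: "trig_polynomial f \<Longrightarrow> trig_polynomial g \<Longrightarrow> trig_polynomial (\<lambda>x. f x + g x)"

lemma trig_polynomial_const: "trig_polynomial (\<lambda>x. c)"
  using trig_polynomial.monomial[of c 0] by simp

lemma trig_polynomial_mult: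
  assumes f: "trig_polynomial f" and g: "trig_polynomial g"
  shows "trig_polynomial (\<lambda>x. f x * g x)"
  using f
proof (induction f rule: trig_polynomial.induct)
  case (monomial c n)
  from g show ?case
  proof (induction g rule: trig_polynomial.induct)
    case (monomial d m)
    show ?case using trig_polynomial.monomial[of "c * d" "n + m"]
      by (simp add: trig_mult[symmetric] mult_ac)
  next
    case (add g1 g2)
    from trig_polynomial.add[OF add.IH] show ?case by (simp add: distrib_left)
  qed
next
  case (add f1 f2)
  from trig_polynomial.add[OF add.IH] show ?case by (simp add: distrib_right)
qed

lemma trig_polynomial_expansion:
  "trig_polynomial f \<Longrightarrow> \<exists>A c. finite A \<and> f = (\<lambda>x. \<Sum>n\<in>A. c n * trig n x)"
proof (induction f rule: trig_polynomial.induct)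
  case (monomial c n)
  show ?case by (rule exI[of _ "{n}"], rule exI[of _ "\<lambda>_. c"]) simp
next
  case (add f g)
  then obtain A B c d where A: "finite A" "f = (\<lambda>x. \<Sum>n\<in>A. c n * trig n x)"
    and B: "finite B" "g = (\<lambda>x. \<Sum>n\<in>B. d n * trig n x)" by blast
  \<comment> \<open>The frequency sets may overlap, so both coefficient families are extended by
    zero and added on the union.\<close>
  let ?e = "\<lambda>n. (if n \<in> A then c n else 0) + (if n \<in> B then d n else 0)"
  have "f x + g x = (\<Sum>n\<in>A \<union> B. ?e n * trig n x)" for x
  proof -
    have "(\<Sum>n\<in>A \<union> B. ?e n * trig n x) = (\<Sum>n\<in>A \<union> B. if n \<in> A then c n * trig n x else 0)
      + (\<Sum>n\<in>A \<union> B. if n \<in> B then d n * trig n x else 0)"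
      unfolding sum.distrib[symmetric] by (intro sum.cong) (auto simp: distrib_right)
    also have "\<dots> = f x + g x"
      using A B by (simp add: sum.inter_restrict[symmetric] Int_absorb1)
    finally show ?thesis by simp
  qed
  then show ?case using A(1) B(1)
    by (intro exI[of _ "A \<union> B"] exI[of _ ?e]) auto
qed

text \<open>A real-linear function of \<open>z\<close> is a combination of \<open>Re z\<close> and
  \<open>Im z\<close>, and on the unit circle these are combinations of \<open>trig 1\<close> and
  \<open>trig (-1)\<close>. Closure under sums and products does the rest.\<close>

lemma trig_polynomial_real_polynomial:
  fixes p :: "complex \<Rightarrow> real"
  assumes "real_polynomial_function p"
  shows "trig_polynomial (\<lambda>x. of_real (p (trig 1 x)))"
  using assms
proof (induction rule: real_polynomial_function.induct)
  case (linear f)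
  then interpret bounded_linear f .
  have "f z = Re z * f 1 + Im z * f \<i>" for z
  proof -
    have "z = Re z *\<^sub>R 1 + Im z *\<^sub>R \<i>" by (simp add: complex_eq_iff)
    then have "f z = f (Re z *\<^sub>R 1 + Im z *\<^sub>R \<i>)" by (rule arg_cong)
    then show ?thesis by (simp only: add scaleR real_scaleR_def)
  qed
  then have f: "of_real (f z) = complex_of_real (Re z) * of_real (f 1) + of_real (Im z) * of_real (f \<i>)" for z
    by (metis of_real_add of_real_mult)
  have re: "complex_of_real (Re (trig 1 x)) = 1/2 * (trig 1 x + trig (-1) x)" for x
    by (simp add: trig_cis complex_eq_iff)
  have im: "complex_of_real (Im (trig 1 x)) = - (\<i>/2) * (trig 1 x - trig (-1) x)" for x
    by (simp add: trig_cis complex_eq_iff)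
  let ?a = "1/2 * complex_of_real (f 1)" and ?b = "\<i>/2 * complex_of_real (f \<i>)"
  have "(\<lambda>x. complex_of_real (f (trig 1 x))) = (\<lambda>x. (?a - ?b) * trig 1 x + (?a + ?b) * trig (-1) x)"
    by (rule ext, subst f) (simp add: re im algebra_simps)
  then show ?case
    using trig_polynomial.add[OF trig_polynomial.monomial[of "?a - ?b" 1] trig_polynomial.monomial[of "?a + ?b" "-1"]]
    by (simp only:)
next
  case (const c)
  show ?case by (rule trig_polynomial_const)
next
  case (add f g)
  from trig_polynomial.add[OF add.IH] show ?case by simp
next
  case (mult f g)
  from trig_polynomial_mult[OF mult.IH] show ?case by simp
qed

section \<open>Density of trigonometric polynomials\<close>

lemma trig_polynomial_uniform_approx:
  fixes h :: "real \<Rightarrow> complex"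
  assumes h: "continuous_on {0..1} h" and h01: "h 0 = h 1" and e: "e > 0"
  obtains p where "trig_polynomial p" "\<And>x. x \<in> {0..1} \<Longrightarrow> cmod (h x - p x) < e"
proof -
  \<comment> \<open>\<open>h\<close> transported to the unit circle, where Stone-Weierstrass applies\<close>
  define F where "F = (\<lambda>z. h (Arg2pi z / (2 * pi)))"
  \<comment> \<open>\<open>Arg2pi\<close> jumps at 1, so \<open>F\<close> is not a composition of
    continuous maps. Its continuity comes from the correspondence between loops and circle maps,
    applied to the trivial homotopy of \<open>h\<close> with itself.\<close>
  have "homotopic_loops UNIV h h"
    using h h01 by (subst homotopic_loops_refl) (simp add: path_def pathfinish_def pathstart_def)
  from homotopic_with_imp_continuous[OF homotopic_loops_imp_homotopic_circlemaps[OF this]]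
  have "continuous_on (sphere 0 1) F" by (simp add: F_def o_def)
  then obtain P where P: "polynomial_function P" "\<And>z. z \<in> sphere 0 1 \<Longrightarrow> cmod (F z - P z) < e"
    using Stone_Weierstrass_polynomial_function[of "sphere 0 1" F e] e by auto
  have "real_polynomial_function (Re \<circ> P)" "real_polynomial_function (Im \<circ> P)"
    using P(1) bounded_linear_Re bounded_linear_Im unfolding polynomial_function_def by blast+
  from this[THEN trig_polynomial_real_polynomial]
  have "trig_polynomial (\<lambda>x. of_real (Re (P (trig 1 x))) + \<i> * of_real (Im (P (trig 1 x))))"
    by (intro trig_polynomial.add trig_polynomial_mult trig_polynomial_const) (simp_all add: o_def)
  then have "trig_polynomial (\<lambda>x. P (trig 1 x))" by (simp flip: complex_eq)
  moreover have "cmod (h x - P (trig 1 x)) < e" if "x \<in> {0..1}" for x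
  proof -
    have "F (trig 1 x) = h x"
    \<comment> \<open>At \<open>x = 1\<close> the argument is 0 instead of \<open>2 * pi\<close>, so
      \<open>F\<close> returns \<open>h 0\<close>, which equals \<open>h 1\<close>.\<close>
    proof (cases "x = 1")
      case True
      then show ?thesis using trig_of_int[of 1 1] h01 by (simp add: F_def Arg2pi_of_real[of 1, simplified])
    next
      case False
      then have "Arg2pi (trig 1 x) = 2 * pi * x"
        using that by (intro Arg2pi_unique[of 1]) (auto simp: trig_def mult_ac)
      then show ?thesis by (simp add: F_def)
    qed
    then show ?thesis using P(2)[of "trig 1 x"] by simp
  qed
  ultimately show ?thesis using that by blast
qed

lemma L2_norm_triangle:
  assumes "square_integrable (lebesgue_on {0..1}) f" "square_integrable (lebesgue_on {0..1}) g"
  shows "L2_norm (\<lambda>x. f x + g x) \<le> L2_norm f + L2_norm g"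
  unfolding L2_norm_eq using Minkowski_integral[OF assms] .

lemma L2_norm_minus: "L2_norm (\<lambda>x. f x - g x) = L2_norm (\<lambda>x. g x - f x)"
  by (simp add: L2_norm_eq norm_minus_commute)

lemma L2_norm_le_sup:
  assumes f: "square_integrable (lebesgue_on {0..1}) f"
    and le: "\<And>x. x \<in> {0..1} \<Longrightarrow> cmod (f x) \<le> C" and C: "0 \<le> C"
  shows "L2_norm f \<le> C"
proof -
  interpret finite_measure "lebesgue_on {0..1::real}" by (rule finite_measure_lebesgue_on_unit)
  have "(LINT x|lebesgue_on {0..1}. (cmod (f x))\<^sup>2) \<le> (LINT x|lebesgue_on {0..1::real}. C\<^sup>2)"
    using f by (intro integral_mono) (auto simp: square_integrable_def intro!: power_mono le)
  also have "\<dots> = C\<^sup>2" by (simp add: measure_restrict_space)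
  finally show ?thesis unfolding L2_norm_eq using C by (intro real_le_lsqrt) auto
qed

lemma continuous_on_square_integrable:
  fixes h :: "real \<Rightarrow> complex"
  assumes "continuous_on {0..1} h"
  shows "square_integrable (lebesgue_on {0..1}) h"
proof -
  have "bounded (h ` {0..1})"
    by (intro compact_imp_bounded compact_continuous_image assms compact_Icc)
  then obtain B where "\<And>x. x \<in> {0..1} \<Longrightarrow> cmod (h x) \<le> B"
    unfolding bounded_iff by blast
  then show ?thesis
    by (intro square_integrable_bounded[where C=B] finite_measure_lebesgue_on_unit
        continuous_imp_measurable_on_sets_lebesgue assms) auto
qed

text \<open>At each point the error is zero once \<open>n\<close> exceeds \<open>cmod (f x)\<close>,
  and its square is dominated by that of \<open>f\<close>; dominated convergence applies.\<close>

lemma L2_truncation: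
  assumes f: "square_integrable (lebesgue_on {0..1}) f" and e: "e > 0"
  obtains C :: nat where "L2_norm (\<lambda>x. f x - (if cmod (f x) \<le> C then f x else 0)) < e"
proof -
  let ?M = "lebesgue_on {0..1::real}"
  let ?s = "\<lambda>n x. (cmod (f x - (if cmod (f x) \<le> real n then f x else 0)))\<^sup>2"
  have [measurable]: "f \<in> borel_measurable ?M" using f by (simp add: square_integrable_def)
  have "(\<lambda>n. integral\<^sup>L ?M (?s n)) \<longlonglongrightarrow> (LINT x|?M. 0)"
  proof (rule integral_dominated_convergence)
    show "integrable ?M (\<lambda>x. (cmod (f x))\<^sup>2)" using f by (simp add: square_integrable_def)
    show "AE x in ?M. (\<lambda>n. ?s n x) \<longlonglongrightarrow> 0"
    proof (rule AE_I2)
      fix x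
      obtain N :: nat where "cmod (f x) \<le> real N" using real_arch_simple by blast
      then have "\<forall>\<^sub>F n in sequentially. ?s n x = 0"
        by (intro eventually_sequentiallyI[of N]) auto
      then show "(\<lambda>n. ?s n x) \<longlonglongrightarrow> 0" by (rule tendsto_eventually)
    qed
  qed (auto intro!: AE_I2)
  from tendsto_real_sqrt[OF this]
  have "(\<lambda>n. L2_norm (\<lambda>x. f x - (if cmod (f x) \<le> real n then f x else 0))) \<longlonglongrightarrow> 0"
    by (simp add: L2_norm_eq)
  from order_tendstoD(2)[OF this e] that show ?thesis
    by (auto simp: eventually_sequentially)
qed

text \<open>Outside a null set a measurable function is a limit of continuous ones. Clamping these
  to a disc supplies a dominating constant, and damping them near the endpoints makes them loops;
  neither spoils the pointwise limit inside the interval.\<close>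

lemma L2_continuous_approx:
  assumes f: "f \<in> borel_measurable (lebesgue :: real measure)" and C: "\<And>x. cmod (f x) \<le> C"
    and e: "e > 0"
  obtains h where "continuous_on {0..1} h" "h 0 = h 1" "L2_norm (\<lambda>x. f x - h x) < e"
proof -
  let ?M = "lebesgue_on {0..1::real}"
  interpret finite_measure ?M by (rule finite_measure_lebesgue_on_unit)
  \<comment> \<open>\<open>C\<close> may be 0; the larger radius is positive, which keeps the
    denominator in \<open>clamp\<close> away from zero.\<close>
  define D where "D = C + 1"
  have D: "D > 0" "\<And>x. cmod (f x) \<le> D"
    using C order_trans[OF norm_ge_zero C] by (auto simp: D_def intro: add_increasing2)
  have "f measurable_on UNIV" by (rule lebesgue_measurable_imp_measurable_on) (use f in auto)
  then obtain N g where N: "negligible N" and g: "\<And>n::nat. continuous_on UNIV (g n)"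
    and lim: "\<And>x. x \<notin> N \<Longrightarrow> (\<lambda>n. g n x) \<longlonglongrightarrow> f x"
    by (auto simp: measurable_on_def)
  define clamp where "clamp z = of_real (D / max D (cmod z)) * z" for z :: complex
  have clamp_le: "cmod (clamp z) \<le> D" for z
    using D(1) by (auto simp: clamp_def norm_mult norm_divide max_def)
  have clamp_id: "clamp z = z" if "cmod z \<le> D" for z
    using D that by (simp add: clamp_def max_def)
  have clamp_cont: "continuous_on UNIV clamp"
    unfolding clamp_def using D by (intro continuous_intros) (auto simp: max_def)
  \<comment> \<open>\<open>cut n\<close> vanishes at 0 and 1, which makes the approximants periodic\<close>
  define cut where "cut n x = min 1 (real n * (x * (1 - x)))" for n :: nat and x :: real
  define h where "h n x = of_real (cut n x) * clamp (g n x)" for n x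
  have h_cont: "continuous_on S (h n)" for S n
    unfolding h_def cut_def
    by (intro continuous_intros continuous_on_compose2[OF clamp_cont]
          continuous_on_subset[OF g]) auto
  have h_le: "cmod (h n x) \<le> D" if "x \<in> {0..1}" for n x
  proof -
    have "0 \<le> cut n x" "cut n x \<le> 1" using that by (auto simp: cut_def)
    then have "cmod (h n x) \<le> 1 * D"
      unfolding h_def norm_mult using clamp_le by (intro mult_mono) auto
    then show ?thesis by simp
  qed
  have h_meas: "h n \<in> borel_measurable ?M" for n
    by (rule continuous_imp_measurable_on_sets_lebesgue[OF h_cont]) auto
  have f_meas: "f \<in> borel_measurable ?M" using f by (rule measurable_restrict_space1)
  have h_lim: "(\<lambda>n. h n x) \<longlonglongrightarrow> f x" if "x \<notin> N" "0 < x" "x < 1" for x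
  proof -
    have "(\<lambda>n. clamp (g n x)) \<longlonglongrightarrow> clamp (f x)"
      using clamp_cont lim[OF that(1)]
      by (auto simp: continuous_on_eq_continuous_at intro: isCont_tendsto_compose)
    moreover have "(\<lambda>n. cut n x) \<longlonglongrightarrow> 1"
    proof (rule tendsto_eventually)
      have p: "x * (1 - x) > 0" using that by simp
      obtain K :: nat where K: "1 / (x * (1 - x)) \<le> real K" using real_arch_simple by blast
      have "cut n x = 1" if "n \<ge> K" for n
      proof -
        have "1 / (x * (1 - x)) \<le> real n" using K that by linarith
        then have "1 \<le> real n * (x * (1 - x))" using p by (simp add: field_simps)
        then show ?thesis by (simp add: cut_def)
      qed
      then show "\<forall>\<^sub>F n in sequentially. cut n x = 1" by (auto intro: eventually_sequentiallyI)
    qed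
    ultimately have "(\<lambda>n. h n x) \<longlonglongrightarrow> of_real 1 * clamp (f x)"
      unfolding h_def by (intro tendsto_intros)
    then show ?thesis using clamp_id[OF D(2)] by simp
  qed
  have "(\<lambda>n. LINT x|?M. (cmod (f x - h n x))\<^sup>2) \<longlonglongrightarrow> (LINT x|?M. 0)"
  proof (rule integral_dominated_convergence)
    show "integrable ?M (\<lambda>x. (2 * D)\<^sup>2)" by simp
    show "(\<lambda>x. (cmod (f x - h n x))\<^sup>2) \<in> borel_measurable ?M" for n
      using h_meas[of n] f_meas by measurable
    show "AE x in ?M. norm ((cmod (f x - h n x))\<^sup>2) \<le> (2 * D)\<^sup>2" for n
    proof (rule AE_I2)
      fix x assume "x \<in> space ?M"
      then have "cmod (f x - h n x) \<le> 2 * D"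
        using norm_triangle_ineq4[of "f x" "h n x"] D(2)[of x] h_le[of x n] by simp
      then have "(cmod (f x - h n x))\<^sup>2 \<le> (2 * D)\<^sup>2" by (rule power_mono) simp
      then show "norm ((cmod (f x - h n x))\<^sup>2) \<le> (2 * D)\<^sup>2" by simp
    qed
    \<comment> \<open>The endpoints join the exceptional set because every \<open>h n\<close>
      vanishes there, whatever the value of \<open>f\<close>.\<close>
    have "negligible (N \<union> {0, 1})" using N by simp
    then have "AE x in lebesgue. x \<notin> N \<union> {0, 1}"
      by (intro AE_not_in) (simp add: negligible_iff_null_sets)
    then have "AE x in ?M. x \<notin> N \<and> 0 < x \<and> x < 1"
      by (subst AE_restrict_space_iff) (auto elim: eventually_mono simp del: Un_insert_right)
    then show "AE x in ?M. (\<lambda>n. (cmod (f x - h n x))\<^sup>2) \<longlonglongrightarrow> 0"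
    proof (rule AE_mp, intro AE_I2 impI)
      fix x assume "x \<notin> N \<and> 0 < x \<and> x < 1"
      then have "(\<lambda>n. (cmod (f x - h n x))\<^sup>2) \<longlonglongrightarrow> (cmod (f x - f x))\<^sup>2"
        by (intro tendsto_intros h_lim) auto
      then show "(\<lambda>n. (cmod (f x - h n x))\<^sup>2) \<longlonglongrightarrow> 0" by simp
    qed
  qed simp
  from tendsto_real_sqrt[OF this] have "(\<lambda>n. L2_norm (\<lambda>x. f x - h n x)) \<longlonglongrightarrow> 0"
    by (simp add: L2_norm_eq)
  from order_tendstoD(2)[OF this e] obtain n where "L2_norm (\<lambda>x. f x - h n x) < e"
    by (auto simp: eventually_sequentially)
  moreover have "h n 0 = h n 1" by (simp add: h_def cut_def)
  ultimately show ?thesis using that h_cont by blast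
qed

lemma trig_polynomial_continuous: "trig_polynomial p \<Longrightarrow> continuous_on S p"
  by (induction rule: trig_polynomial.induct) (intro continuous_intros continuous_trig; assumption)+

text \<open>Three approximations, each costing at most \<open>e / 3\<close>: truncation to a bounded
  function, then a continuous loop in norm, then a trigonometric polynomial uniformly.\<close>

lemma trig_polynomial_dense:
  assumes f: "f \<in> periodic_L2" and e: "e > 0"
  obtains p where "trig_polynomial p" "L2_norm (\<lambda>x. f x - p x) < e"
proof -
  let ?M = "lebesgue_on {0..1::real}"
  have f2: "square_integrable ?M f" using f by (rule periodic_L2_square_integrable)
  have [measurable]: "f \<in> borel_measurable lebesgue" using f by (simp add: periodic_L2_def)
  obtain C :: nat where C: "L2_norm (\<lambda>x. f x - (if cmod (f x) \<le> C then f x else 0)) < e / 3"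
    using L2_truncation[OF f2, of "e / 3"] e by auto
  define u where "u x = (if cmod (f x) \<le> C then f x else 0)" for x
  have um: "u \<in> borel_measurable lebesgue" unfolding u_def by measurable
  have ub: "cmod (u x) \<le> C" for x by (simp add: u_def)
  have u2: "square_integrable ?M u"
    by (intro square_integrable_bounded[where C=C] finite_measure_lebesgue_on_unit
        measurable_restrict_space1 um ub)
  obtain h where h: "continuous_on {0..1} h" "h 0 = h 1" "L2_norm (\<lambda>x. u x - h x) < e / 3"
    using L2_continuous_approx[OF um ub, of "e / 3"] e by auto
  obtain p where p: "trig_polynomial p" "\<And>x. x \<in> {0..1} \<Longrightarrow> cmod (h x - p x) < e / 3"
    using trig_polynomial_uniform_approx[OF h(1,2), of "e / 3"] e by auto
  have h2: "square_integrable ?M h" by (rule continuous_on_square_integrable[OF h(1)])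
  have p2: "square_integrable ?M p"
    by (intro continuous_on_square_integrable trig_polynomial_continuous p(1))
  note sq = f2 u2 h2 p2 square_integrable_diff square_integrable_add
  have "L2_norm (\<lambda>x. f x - p x) = L2_norm (\<lambda>x. (f x - u x) + ((u x - h x) + (h x - p x)))" by simp
  also have "\<dots> \<le> L2_norm (\<lambda>x. f x - u x) + L2_norm (\<lambda>x. (u x - h x) + (h x - p x))"
    by (intro L2_norm_triangle sq)
  also have "L2_norm (\<lambda>x. (u x - h x) + (h x - p x)) \<le> L2_norm (\<lambda>x. u x - h x) + L2_norm (\<lambda>x. h x - p x)"
    by (intro L2_norm_triangle sq)
  also have "L2_norm (\<lambda>x. h x - p x) \<le> e / 3"
    by (intro L2_norm_le_sup sq) (use p(2) e in \<open>auto intro: less_imp_le\<close>)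
  finally have "L2_norm (\<lambda>x. f x - p x) < e"
    using C h(3) by (simp add: u_def)
  with p(1) that show ?thesis by blast
qed

section \<open>Fourier coefficients of trigonometric sums and of translates\<close>

lemma L2_inner_add_left:
  assumes "square_integrable (lebesgue_on {0..1}) f" "square_integrable (lebesgue_on {0..1}) g"
    "square_integrable (lebesgue_on {0..1}) h"
  shows "L2_inner (\<lambda>x. f x + g x) h = L2_inner f h + L2_inner g h"
  unfolding L2_inner_eq distrib_right
  using square_integrable_mult_cnj assms by (intro Bochner_Integration.integral_add) auto

lemma L2_inner_trig_sum_left:
  assumes g: "square_integrable (lebesgue_on {0..1}) g"
  shows "L2_inner (\<lambda>x. \<Sum>n\<in>A. c n * trig n x) g = (\<Sum>n\<in>A. c n * cnj (fourier_coeff g n))"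
proof -
  have int: "integrable (lebesgue_on {0..1}) (\<lambda>x. c n * (trig n x * cnj (g x)))" for n
    using square_integrable_mult_cnj[OF periodic_L2_square_integrable[OF periodic_L2_trig] g] by simp
  have "L2_inner (\<lambda>x. \<Sum>n\<in>A. c n * trig n x) g
      = (LINT x|lebesgue_on {0..1}. (\<Sum>n\<in>A. c n * (trig n x * cnj (g x))))"
    by (simp add: L2_inner_eq sum_distrib_right mult.assoc)
  also have "\<dots> = (\<Sum>n\<in>A. c n * L2_inner (trig n) g)"
    using int by (subst Bochner_Integration.integral_sum) (auto simp: L2_inner_eq)
  also have "\<dots> = (\<Sum>n\<in>A. c n * cnj (fourier_coeff g n))"
    by (simp add: fourier_coeff_eq flip: L2_inner_cnj)
  finally show ?thesis .
qed

lemma trig_sum_periodic_L2: "(\<lambda>x. \<Sum>n\<in>A. c n * trig n x) \<in> periodic_L2"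
proof (rule periodic_L2I)
  have "continuous_on UNIV (\<lambda>x. \<Sum>n\<in>A. c n * trig n x)"
    by (intro continuous_intros continuous_trig)
  from continuous_imp_measurable_on_sets_lebesgue[OF this]
  show "(\<lambda>x. \<Sum>n\<in>A. c n * trig n x) \<in> borel_measurable lebesgue" by simp
  show "square_integrable (lebesgue_on {0..1}) (\<lambda>x. \<Sum>n\<in>A. c n * trig n x)"
    by (intro square_integrable_sum square_integrable_scale periodic_L2_square_integrable periodic_L2_trig)
qed simp

lemma trig_polynomial_periodic_L2: "trig_polynomial p \<Longrightarrow> p \<in> periodic_L2"
  using trig_polynomial_expansion trig_sum_periodic_L2 by blast

lemma periodic_L2_diff:
  assumes "f \<in> periodic_L2" "g \<in> periodic_L2"
  shows "(\<lambda>x. f x - g x) \<in> periodic_L2"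
proof (rule periodic_L2I)
  show "(\<lambda>x. f x - g x) \<in> borel_measurable lebesgue"
    using assms by (auto simp: periodic_L2_def)
  show "f (x + 1) - g (x + 1) = f x - g x" for x
    using assms by (auto simp: periodic_L2_def)
qed (intro square_integrable_diff periodic_L2_square_integrable assms)

lemma fourier_coeff_trig_sum:
  assumes "finite A" "n \<in> A"
  shows "fourier_coeff (\<lambda>x. \<Sum>n\<in>A. c n * trig n x) n = c n"
proof -
  have "fourier_coeff (\<lambda>x. \<Sum>n\<in>A. c n * trig n x) n = (\<Sum>l\<in>A. c l * cnj (fourier_coeff (trig n) l))"
    unfolding fourier_coeff_eq[of "\<lambda>x. \<Sum>n\<in>A. c n * trig n x"]
    by (rule L2_inner_trig_sum_left) (rule periodic_L2_square_integrable[OF periodic_L2_trig])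
  also have "\<dots> = (\<Sum>l\<in>A. if l = n then c l else 0)"
    by (intro sum.cong) (auto simp: fourier_coeff_eq L2_inner_trig)
  also have "\<dots> = c n" using assms by simp
  finally show ?thesis .
qed

lemma L2_norm_trig_sum:
  assumes "finite A"
  shows "(L2_norm (\<lambda>x. \<Sum>n\<in>A. c n * trig n x))\<^sup>2 = (\<Sum>n\<in>A. (cmod (c n))\<^sup>2)"
proof -
  let ?f = "\<lambda>x. \<Sum>n\<in>A. c n * trig n x"
  have "L2_inner ?f ?f = (\<Sum>n\<in>A. c n * cnj (fourier_coeff ?f n))"
    by (rule L2_inner_trig_sum_left) (rule periodic_L2_square_integrable[OF trig_sum_periodic_L2])
  also have "\<dots> = (\<Sum>n\<in>A. of_real ((cmod (c n))\<^sup>2))"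
    using assms by (intro sum.cong) (auto simp only: fourier_coeff_trig_sum complex_norm_square)
  finally have "Re (L2_inner ?f ?f) = (\<Sum>n\<in>A. (cmod (c n))\<^sup>2)" by simp
  then show ?thesis by (simp add: L2_norm_def sum_nonneg)
qed

text \<open>Translating the whole integrand of the coefficient by \<open>t\<close> leaves the
  integral unchanged and splits off the factor \<open>cnj (trig n t)\<close>, whose inverse is
  \<open>trig n t\<close>.\<close>

lemma fourier_coeff_shift:
  assumes f: "f \<in> periodic_L2"
  shows "fourier_coeff (\<lambda>x. f (x + t)) n = trig n t * fourier_coeff f n"
proof -
  have per: "f (x + 1) * cnj (trig n (x + 1)) = f x * cnj (trig n x)" for x
    using f by (simp add: periodic_L2_def)
  have int: "set_integrable lebesgue {0..1} (\<lambda>x. f x * cnj (trig n x))"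
    using square_integrable_mult_cnj[OF periodic_L2_square_integrable[OF f]
        periodic_L2_square_integrable[OF periodic_L2_trig, of n]]
    by (simp add: set_integrable_def integrable_restrict_space)
  have unit: "trig n t * cnj (trig n t) = 1"
    by (simp add: complex_norm_square[symmetric])
  have "fourier_coeff f n = (LINT x:{0..1}|lebesgue. f (x + t) * cnj (trig n (x + t)))"
    using periodic_integral_shift(2)[OF per int, of t] by (simp add: fourier_coeff_eq L2_inner_def)
  also have "\<dots> = (LINT x:{0..1}|lebesgue. cnj (trig n t) * (f (x + t) * cnj (trig n x)))"
    by (simp add: trig_add mult_ac del: set_integral_mult_right)
  also have "\<dots> = cnj (trig n t) * fourier_coeff (\<lambda>x. f (x + t)) n"
    by (simp add: fourier_coeff_eq L2_inner_def)
  finally show ?thesis using unit by (simp add: mult.assoc[symmetric])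
qed

subsection \<open>Dyadic shifts\<close>

lemma finite_dyadic_residues [simp]: "finite (dyadic_residues j)"
  by (simp add: dyadic_residues_def)

text \<open>Treats level 0 together with the others: the character sum below only needs a block of
  \<open>2 ^ j\<close> consecutive integers.\<close>

lemma dyadic_residues_eq: "\<exists>a. dyadic_residues j = {a..<a + 2 ^ j}"
proof (cases j)
  case 0
  then show ?thesis by (intro exI[of _ 0]) (auto simp: dyadic_residues_def)
next
  case (Suc i)
  then show ?thesis
    by (intro exI[of _ "- (2 ^ i) + 1"]) (auto simp: dyadic_residues_def)
qed

lemma bij_betw_dyadic_residues:
  obtains a where "bij_betw (\<lambda>i. int i + a) {..<2 ^ j} (dyadic_residues j)"
proof -
  obtain a where a: "dyadic_residues j = {a..<a + 2 ^ j}" using dyadic_residues_eq by blast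
  have "bij_betw (\<lambda>i. int i + a) {..<2 ^ j} {a..<a + 2 ^ j}"
    by (rule bij_betwI[where g="\<lambda>k. nat (k - a)"]) (auto simp: nat_less_iff zless_nat_eq_int_zless)
  then show ?thesis using that a by simp
qed

lemma trig_eq_1_iff: "trig n t = 1 \<longleftrightarrow> of_int n * t \<in> \<int>"
proof -
  have "trig n t = 1 \<longleftrightarrow> (\<exists>k::int. 2 * pi * of_int n * t = of_int k * (2 * pi))"
    by (simp add: trig_def exp_eq_1 mult_ac)
  also have "\<dots> \<longleftrightarrow> (\<exists>k::int. of_int n * t = of_int k)"
    by (intro iff_exI) (auto simp: mult_ac)
  finally show ?thesis by (auto simp: Ints_def)
qed

lemma trig_dyadic_eq_1_iff: "trig d (1 / 2 ^ j) = 1 \<longleftrightarrow> 2 ^ j dvd d"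
proof
  assume "trig d (1 / 2 ^ j) = 1"
  then obtain k where "real_of_int d / 2 ^ j = of_int k" by (auto simp: trig_eq_1_iff Ints_def)
  then have "real_of_int d = of_int (2 ^ j * k)" by (simp add: field_simps)
  then show "2 ^ j dvd d" by (simp only: of_int_eq_iff dvd_triv_left)
next
  assume "2 ^ j dvd d"
  then show "trig d (1 / 2 ^ j) = 1" by (auto simp: trig_eq_1_iff)
qed

lemma trig_of_nat_mult: "trig n (of_nat k * t) = trig n t ^ k"
  by (induction k) (simp_all add: trig_add distrib_right)

text \<open>Orthogonality of characters modulo \<open>2 ^ j\<close>. Up to a factor for the start of
  the block this is a geometric sum in the root of unity \<open>?w\<close>, and
  \<open>?w = 1\<close> exactly when \<open>2 ^ j\<close> divides \<open>d\<close>.\<close>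

lemma sum_trig_dyadic_residues:
  "(\<Sum>k\<in>dyadic_residues j. trig d (of_int k / 2 ^ j)) = (if 2 ^ j dvd d then 2 ^ j else 0)"
proof -
  let ?w = "trig d (1 / 2 ^ j)"
  obtain a where a: "bij_betw (\<lambda>i. int i + a) {..<2 ^ j} (dyadic_residues j)"
    by (rule bij_betw_dyadic_residues)
  have "(\<Sum>k\<in>dyadic_residues j. trig d (of_int k / 2 ^ j))
      = (\<Sum>i<2 ^ j. trig d (of_int (int i + a) / 2 ^ j))"
    by (rule sum.reindex_bij_betw[OF a, symmetric])
  also have "\<dots> = (\<Sum>i<2 ^ j. trig d (of_int a / 2 ^ j) * ?w ^ i)"
    unfolding trig_of_nat_mult[symmetric] trig_add[symmetric]
    by (simp add: add_divide_distrib add.commute)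
  also have "\<dots> = trig d (of_int a / 2 ^ j) * (\<Sum>i<2 ^ j. ?w ^ i)"
    by (simp add: sum_distrib_left)
  also have "\<dots> = (if 2 ^ j dvd d then 2 ^ j else 0)"
  proof (cases "2 ^ j dvd d")
    case True
    then have w: "?w = 1" by (simp add: trig_dyadic_eq_1_iff)
    have "real_of_int d * (of_int a / 2 ^ j) = of_int ((d div 2 ^ j) * a)"
      using True by auto
    then have "trig d (of_int a / 2 ^ j) = 1" unfolding trig_eq_1_iff by (metis Ints_of_int)
    then show ?thesis using True w by simp
  next
    case False
    then have "?w \<noteq> 1" by (simp add: trig_dyadic_eq_1_iff)
    moreover have "?w ^ (2 ^ j) = 1"
      using trig_of_int[of d 1] by (simp flip: trig_of_nat_mult)
    ultimately show ?thesis using False by (simp add: geometric_sum)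
  qed
  finally show ?thesis .
qed

section \<open>Extending the Parseval identity from trigonometric polynomials by density\<close>

text \<open>Nothing dyadic enters, only growing finite index sets. First the seminorms
  \<open>E J\<close> are bounded by the norm everywhere, uniformly in \<open>J\<close>; this bound
  then controls the error when \<open>f\<close> is replaced by a nearby polynomial in the
  limit.\<close>

lemma tendsto_frame_sum_of_trig:
  fixes I :: "nat \<Rightarrow> 'i set" and g :: "'i \<Rightarrow> real \<Rightarrow> complex"
  assumes fin: "\<And>J. finite (I J)" and mono: "mono I"
    and g: "\<And>J i. i \<in> I J \<Longrightarrow> g i \<in> periodic_L2"
    and trig: "\<And>p. trig_polynomial p \<Longrightarrow>
      (\<lambda>J. \<Sum>i\<in>I J. (cmod (L2_inner p (g i)))\<^sup>2) \<longlonglongrightarrow> (L2_norm p)\<^sup>2"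
    and f: "f \<in> periodic_L2"
  shows "(\<lambda>J. \<Sum>i\<in>I J. (cmod (L2_inner f (g i)))\<^sup>2) \<longlonglongrightarrow> (L2_norm f)\<^sup>2"
proof -
  define E where "E J u = L2_set (\<lambda>i. cmod (L2_inner u (g i))) (I J)" for J u
  let ?M = "lebesgue_on {0..1::real}"
  note sq = periodic_L2_square_integrable
  have N0: "L2_norm u \<ge> 0" for u by (simp add: L2_norm_eq)
  have tri: "E J (\<lambda>x. u x + v x) \<le> E J u + E J v"
    if "u \<in> periodic_L2" "v \<in> periodic_L2" for J u v
  proof -
    have "E J (\<lambda>x. u x + v x) \<le> L2_set (\<lambda>i. cmod (L2_inner u (g i)) + cmod (L2_inner v (g i))) (I J)"
      unfolding E_def
      by (intro L2_set_mono)
         (auto simp: L2_inner_add_left[OF sq[OF that(1)] sq[OF that(2)] sq[OF g]] intro: norm_triangle_ineq)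
    also have "\<dots> \<le> E J u + E J v" unfolding E_def by (rule L2_set_triangle_ineq)
    finally show ?thesis .
  qed
  \<comment> \<open>A crude constant that may grow with \<open>J\<close>. It only gives continuity
    of \<open>E J\<close> for fixed \<open>J\<close>, until the uniform bound \<open>E_le\<close> is
    available.\<close>
  define B where "B J = (\<Sum>i\<in>I J. L2_norm (g i))" for J
  have B0: "B J \<ge> 0" for J by (simp add: B_def N0 sum_nonneg)
  have bound: "E J u \<le> B J * L2_norm u" if "u \<in> periodic_L2" for J u
  proof -
    have "E J u \<le> (\<Sum>i\<in>I J. cmod (L2_inner u (g i)))"
      unfolding E_def by (rule L2_set_le_sum) auto
    also have "\<dots> \<le> (\<Sum>i\<in>I J. L2_norm u * L2_norm (g i))"
      unfolding L2_inner_eq L2_norm_eq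
      by (intro sum_mono Cauchy_Schwarz_integral sq that g) auto
    finally show ?thesis by (simp add: B_def sum_distrib_left[symmetric] mult.commute)
  qed
  have Ep: "(\<lambda>J. E J p) \<longlonglongrightarrow> L2_norm p" if "trig_polynomial p" for p
    using tendsto_real_sqrt[OF trig[OF that]] N0[of p] by (simp add: E_def L2_set_def)
  \<comment> \<open>An increasing sequence stays below its limit, so on polynomials the bound by the
    norm holds for each \<open>J\<close>.\<close>
  have "incseq (\<lambda>J. E J p)" for p
    unfolding E_def L2_set_def
    by (intro incseq_SucI real_sqrt_le_mono sum_mono2 fin) (use mono in \<open>auto simp: mono_def\<close>)
  then have Ep_le: "E J p \<le> L2_norm p" if "trig_polynomial p" for p J
    by (rule incseq_le[OF _ Ep[OF that]])
  have E_le: "E J u \<le> L2_norm u" if u: "u \<in> periodic_L2" for J u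
  proof (rule field_le_epsilon)
    fix e :: real assume "e > 0"
    \<comment> \<open>The approximation error enters once through the norm of \<open>p\<close> and
      \<open>B J\<close> times through \<open>bound\<close>.\<close>
    then have "e / (1 + B J) > 0" using B0[of J] by simp
    then obtain p where p: "trig_polynomial p" "L2_norm (\<lambda>x. u x - p x) < e / (1 + B J)"
      using trig_polynomial_dense[OF u] by blast
    note pL = trig_polynomial_periodic_L2[OF p(1)]
    note up = periodic_L2_diff[OF u pL] and pu = periodic_L2_diff[OF pL u]
    have "E J u \<le> E J p + E J (\<lambda>x. u x - p x)" using tri[OF pL up] by simp
    also have "\<dots> \<le> L2_norm p + B J * L2_norm (\<lambda>x. u x - p x)"
      by (intro add_mono Ep_le p bound up)
    also have "L2_norm p \<le> L2_norm u + L2_norm (\<lambda>x. u x - p x)"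
      using L2_norm_triangle[OF sq[OF u] sq[OF pu]] by (simp add: L2_norm_minus[of p u])
    finally have "E J u \<le> L2_norm u + (1 + B J) * L2_norm (\<lambda>x. u x - p x)"
      by (simp add: algebra_simps)
    also have "\<dots> \<le> L2_norm u + (1 + B J) * (e / (1 + B J))"
      using p(2) B0[of J] by (intro add_left_mono mult_left_mono) auto
    finally show "E J u \<le> L2_norm u + e" using B0[of J] by simp
  qed
  have "(\<lambda>J. E J f) \<longlonglongrightarrow> L2_norm f"
  proof (rule order_tendstoI)
    fix a assume "a < L2_norm f"
    \<comment> \<open>The error is spent twice: in passing from the norm of \<open>f\<close> to that
      of \<open>p\<close>, and from \<open>E J p\<close> back to \<open>E J f\<close>. Half the gap
      therefore suffices.\<close>
    then have e: "(L2_norm f - a) / 2 > 0" (is "?e > 0") by simp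
    obtain p where p: "trig_polynomial p" "L2_norm (\<lambda>x. f x - p x) < ?e"
      using trig_polynomial_dense[OF f e] by blast
    note pL = trig_polynomial_periodic_L2[OF p(1)]
    note fp = periodic_L2_diff[OF f pL] and pf = periodic_L2_diff[OF pL f]
    have "L2_norm f \<le> L2_norm p + L2_norm (\<lambda>x. f x - p x)"
      using L2_norm_triangle[OF sq[OF pL] sq[OF fp]] by simp
    then have "a + L2_norm (\<lambda>x. f x - p x) < L2_norm p" using p(2) by (simp add: field_simps)
    from order_tendstoD(1)[OF Ep[OF p(1)] this]
    show "\<forall>\<^sub>F J in sequentially. a < E J f"
    proof eventually_elim
      case (elim J)
      have "E J p \<le> E J f + E J (\<lambda>x. p x - f x)" using tri[OF f pf] by simp
      also have "E J (\<lambda>x. p x - f x) \<le> L2_norm (\<lambda>x. f x - p x)"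
        using E_le[OF pf] by (simp add: L2_norm_minus[of p f])
      finally show ?case using elim by simp
    qed
  next
    fix a assume "L2_norm f < a"
    then show "\<forall>\<^sub>F J in sequentially. E J f < a"
      by (intro always_eventually allI order.strict_trans1[OF E_le[OF f]])
  qed
  from tendsto_power[OF this, of 2] show ?thesis
    by (simp add: E_def L2_set_def sum_nonneg)
qed

subsection \<open>The energy of a level as a Hermitian form\<close>

text \<open>The matrix of the energy form of level \<open>j\<close>. The case distinction and the
  factor \<open>2 ^ j\<close> are the character sum \<open>sum_trig_dyadic_residues\<close> at
  \<open>d = l - n\<close>.\<close>

definition gram :: "(nat \<Rightarrow> nat) \<Rightarrow> (nat \<Rightarrow> nat \<Rightarrow> real \<Rightarrow> complex) \<Rightarrow> nat \<Rightarrow> int \<Rightarrow> int \<Rightarrow> complex" where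
  "gram \<rho> \<psi> j n l = (if 2 ^ j dvd l - n then 2 ^ j * (\<Sum>m=1..\<rho> j.
     cnj (fourier_coeff (\<psi> j m) n) * fourier_coeff (\<psi> j m) l) else 0)"

text \<open>Each squared modulus expands into a double sum over frequencies in which
  \<open>k\<close> occurs only in the phase \<open>trig (l - n) (of_int k / 2 ^ j)\<close>. Moving
  the sum over \<open>k\<close> inside leaves the character sum.\<close>

lemma level_energy_trig_sum:
  assumes \<psi>: "\<And>m. m \<in> {1..\<rho> j} \<Longrightarrow> \<psi> j m \<in> periodic_L2"
    and f: "f = (\<lambda>x. \<Sum>n\<in>A. c n * trig n x)"
  shows "of_real (\<Sum>m=1..\<rho> j. \<Sum>k\<in>dyadic_residues j. (cmod (L2_inner f (dyadic_shift j k (\<psi> j m))))\<^sup>2)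
    = (\<Sum>n\<in>A. \<Sum>l\<in>A. c n * cnj (c l) * gram \<rho> \<psi> j n l)"
proof -
  let ?F = "\<lambda>m n. fourier_coeff (\<psi> j m) n"
  have coeff: "of_real ((cmod (L2_inner f (dyadic_shift j k (\<psi> j m))))\<^sup>2) =
      (\<Sum>n\<in>A. \<Sum>l\<in>A. c n * cnj (c l) * (cnj (?F m n) * ?F m l) * trig (l - n) (of_int k / 2 ^ j))"
    if m: "m \<in> {1..\<rho> j}" for m k
  proof -
    let ?t = "of_int k / 2 ^ j :: real"
    have "L2_inner f (dyadic_shift j k (\<psi> j m)) = (\<Sum>n\<in>A. c n * cnj (trig n ?t * ?F m n))"
      unfolding f dyadic_shift_def
      using L2_inner_trig_sum_left[OF periodic_L2_square_integrable[OF periodic_L2_shift[OF \<psi>[OF m]]]]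
      by (simp add: fourier_coeff_shift[OF \<psi>[OF m]])
    then have "of_real ((cmod (L2_inner f (dyadic_shift j k (\<psi> j m))))\<^sup>2)
      = (\<Sum>n\<in>A. c n * cnj (trig n ?t * ?F m n)) * (\<Sum>l\<in>A. cnj (c l) * (trig l ?t * ?F m l))"
      by (simp only: complex_norm_square) simp
    also have "\<dots> = (\<Sum>n\<in>A. \<Sum>l\<in>A. c n * cnj (c l) * (cnj (?F m n) * ?F m l) * (trig l ?t * trig (- n) ?t))"
      unfolding sum_product by (intro sum.cong refl) (simp add: cnj_trig mult_ac)
    finally show ?thesis by (simp add: trig_mult)
  qed
  have "of_real (\<Sum>m=1..\<rho> j. \<Sum>k\<in>dyadic_residues j. (cmod (L2_inner f (dyadic_shift j k (\<psi> j m))))\<^sup>2)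
    = (\<Sum>m=1..\<rho> j. \<Sum>k\<in>dyadic_residues j. \<Sum>n\<in>A. \<Sum>l\<in>A.
        c n * cnj (c l) * (cnj (?F m n) * ?F m l) * trig (l - n) (of_int k / 2 ^ j))"
    unfolding of_real_sum by (intro sum.cong refl coeff)
  also have "\<dots> = (\<Sum>m=1..\<rho> j. \<Sum>n\<in>A. \<Sum>l\<in>A.
        c n * cnj (c l) * (cnj (?F m n) * ?F m l) * (\<Sum>k\<in>dyadic_residues j. trig (l - n) (of_int k / 2 ^ j)))"
    unfolding sum_distrib_left
    by (rule sum.cong[OF refl], rule trans[OF sum.swap], rule sum.cong[OF refl], rule sum.swap)
  also have "\<dots> = (\<Sum>n\<in>A. \<Sum>l\<in>A. \<Sum>m=1..\<rho> j.
        c n * cnj (c l) * (cnj (?F m n) * ?F m l) * (if 2 ^ j dvd l - n then 2 ^ j else 0))"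
    unfolding sum_trig_dyadic_residues
    by (rule trans[OF sum.swap], rule sum.cong[OF refl], rule sum.swap)
  also have "\<dots> = (\<Sum>n\<in>A. \<Sum>l\<in>A. c n * cnj (c l) * gram \<rho> \<psi> j n l)"
    by (intro sum.cong refl) (simp add: gram_def sum_distrib_left mult_ac)
  finally show ?thesis .
qed

lemma gram_diag:
  "gram \<rho> \<psi> j n n = of_real (\<Sum>m=1..\<rho> j. 2 ^ j * (cmod (fourier_coeff (\<psi> j m) n))\<^sup>2)"
proof -
  have "complex_of_real (2 ^ j) = 2 ^ j" by simp
  then show ?thesis
    unfolding gram_def of_real_sum of_real_mult complex_norm_square
    by (simp add: sum_distrib_left mult.commute[of "cnj _"])
qed

text \<open>\<open>v\<close> is the 2-adic valuation of \<open>d\<close>. Applied to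
  \<open>l - n\<close>, it matches off-diagonal entries with the exponents and odd factors in the
  second condition.\<close>

lemma two_power_odd_decomposition:
  assumes "(d::int) \<noteq> 0"
  obtains v k where "d = 2 ^ v * k" "odd k"
proof -
  obtain k where "d = 2 ^ multiplicity 2 d * k" "\<not> 2 dvd k"
    using multiplicity_decompose'[of d 2] assms by auto
  then show ?thesis using that by blast
qed

text \<open>Since \<open>k\<close> is odd, \<open>2 ^ j\<close> divides \<open>2 ^ v * k\<close>
  only for \<open>j \<le> v\<close>. The series is thus a finite sum, the left side of the second
  condition.\<close>

lemma gram_offdiag_sums:
  assumes l: "l = 2 ^ v * k + n" and k: "odd k"
  shows "(\<lambda>j. gram \<rho> \<psi> j n l) sums (\<Sum>q=0..v. 2 ^ q * (\<Sum>m=1..\<rho> q.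
      cnj (fourier_coeff (\<psi> q m) n) * fourier_coeff (\<psi> q m) (2 ^ v * k + n)))"
proof -
  have dvd: "2 ^ j dvd l - n \<longleftrightarrow> j \<le> v" for j
  proof
    assume "2 ^ j dvd l - n"
    then have d: "2 ^ j dvd 2 ^ v * k" using l by simp
    have "coprime ((2::int) ^ j) k" using k by simp
    then have "(2::int) ^ j dvd 2 ^ v" using d by (simp add: coprime_dvd_mult_left_iff)
    then show "j \<le> v" by (simp add: dvd_power_iff)
  next
    assume "j \<le> v"
    then have "(2::int) ^ j dvd 2 ^ v" by (rule le_imp_power_dvd)
    then show "2 ^ j dvd l - n" using l by simp
  qed
  have "(\<lambda>j. gram \<rho> \<psi> j n l) sums (\<Sum>q\<in>{0..v}. gram \<rho> \<psi> q n l)"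
    by (rule sums_finite) (auto simp: gram_def dvd)
  also have "(\<Sum>q\<in>{0..v}. gram \<rho> \<psi> q n l) = (\<Sum>q=0..v. 2 ^ q * (\<Sum>m=1..\<rho> q.
      cnj (fourier_coeff (\<psi> q m) n) * fourier_coeff (\<psi> q m) (2 ^ v * k + n)))"
    unfolding l[symmetric] by (intro sum.cong refl) (simp add: gram_def dvd)
  finally show ?thesis .
qed

text \<open>Allows a convergent two-frequency form to be split into its separate entries.\<close>

lemma gram_offdiag_summable:
  assumes "n \<noteq> l"
  shows "summable (\<lambda>j. gram \<rho> \<psi> j n l)"
proof -
  obtain v k where vk: "l - n = 2 ^ v * k" "odd k"
    using two_power_odd_decomposition[of "l - n"] assms by auto
  then have "l = 2 ^ v * k + n" by simp
  from gram_offdiag_sums[OF this vk(2)] show ?thesis by (rule sums_summable)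
qed

text \<open>The right side is the Parseval identity for all finite trigonometric sums, read in the
  complex numbers because single entries of \<open>gram\<close> need not be real. Density gives the
  converse direction.\<close>

lemma parseval_wavelet_frame_iff_trig:
  assumes \<psi>: "\<And>j m. m \<in> {1..\<rho> j} \<Longrightarrow> \<psi> j m \<in> periodic_L2"
  shows "parseval_wavelet_frame \<rho> \<psi> \<longleftrightarrow>
    (\<forall>A c. finite A \<longrightarrow> (\<lambda>j. \<Sum>n\<in>A. \<Sum>l\<in>A. c n * cnj (c l) * gram \<rho> \<psi> j n l) sums (\<Sum>n\<in>A. c n * cnj (c n)))"
    (is "_ \<longleftrightarrow> ?R")
proof -
  define T where "T f j = (\<Sum>m=1..\<rho> j. \<Sum>k\<in>dyadic_residues j.
               (cmod (L2_inner f (dyadic_shift j k (\<psi> j m))))\<^sup>2)" for f j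
  have trig: "T (\<lambda>x. \<Sum>n\<in>A. c n * trig n x) sums (L2_norm (\<lambda>x. \<Sum>n\<in>A. c n * trig n x))\<^sup>2 \<longleftrightarrow>
     (\<lambda>j. \<Sum>n\<in>A. \<Sum>l\<in>A. c n * cnj (c l) * gram \<rho> \<psi> j n l) sums (\<Sum>n\<in>A. c n * cnj (c n))"
    if A: "finite A" for A c
  proof -
    let ?f = "\<lambda>x. \<Sum>n\<in>A. c n * trig n x"
    have "(\<lambda>j. complex_of_real (T ?f j)) = (\<lambda>j. \<Sum>n\<in>A. \<Sum>l\<in>A. c n * cnj (c l) * gram \<rho> \<psi> j n l)"
      unfolding T_def by (rule ext, rule level_energy_trig_sum[OF \<psi> refl])
    moreover have "complex_of_real ((L2_norm ?f)\<^sup>2) = (\<Sum>n\<in>A. c n * cnj (c n))"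
      unfolding L2_norm_trig_sum[OF A] of_real_sum complex_norm_square ..
    ultimately show ?thesis
      using sums_of_real_iff[where 'a=complex, of "T ?f" "(L2_norm ?f)\<^sup>2"] by (simp only:)
  qed
  show ?thesis
  proof
    assume "parseval_wavelet_frame \<rho> \<psi>"
    then have P: "T f sums (L2_norm f)\<^sup>2" if "f \<in> periodic_L2" for f
      using that unfolding parseval_wavelet_frame_def T_def[abs_def] by (rule bspec)
    show ?R
      by (intro allI impI P trig[THEN iffD1] trig_sum_periodic_L2)
  next
    assume R: ?R
    define g where "g = (\<lambda>(j, m, k). dyadic_shift j k (\<psi> j m))"
    \<comment> \<open>Flattens the partial sum over levels \<open>j < J\<close> into one sum over a
      finite set of triples that grows with \<open>J\<close>, as the density lemma expects.\<close>
    define I where "I J = (SIGMA j:{..<J}. SIGMA m:{1..\<rho> j}. dyadic_residues j)" for J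
    have I: "(\<Sum>j<J. T f j) = (\<Sum>i\<in>I J. (cmod (L2_inner f (g i)))\<^sup>2)" for J f
      by (simp add: T_def I_def g_def sum.Sigma split_def)
    have "(\<lambda>J. \<Sum>i\<in>I J. (cmod (L2_inner f (g i)))\<^sup>2) \<longlonglongrightarrow> (L2_norm f)\<^sup>2"
      if "f \<in> periodic_L2" for f
    proof (rule tendsto_frame_sum_of_trig)
      show "finite (I J)" for J by (auto simp: I_def)
      show "mono I" by (auto simp: I_def mono_def)
      show "g i \<in> periodic_L2" if "i \<in> I J" for J i
        using that periodic_L2_shift[OF \<psi>] by (auto simp: I_def g_def dyadic_shift_def)
      show "(\<lambda>J. \<Sum>i\<in>I J. (cmod (L2_inner p (g i)))\<^sup>2) \<longlonglongrightarrow> (L2_norm p)\<^sup>2"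
        if p: "trig_polynomial p" for p
      proof -
        obtain A c where A: "finite A" "p = (\<lambda>x. \<Sum>n\<in>A. c n * trig n x)"
          using trig_polynomial_expansion[OF p] by blast
        have "T p sums (L2_norm p)\<^sup>2"
          unfolding A(2) by (rule trig[OF A(1), THEN iffD2, OF R[rule_format, OF A(1)]])
        then show ?thesis by (simp add: sums_def I)
      qed
    qed fact
    then show "parseval_wavelet_frame \<rho> \<psi>"
      unfolding parseval_wavelet_frame_def T_def[symmetric] by (simp add: sums_def I)
  qed
qed

section \<open>From the summed Hermitian forms to the two coefficient conditions\<close>

theorem theorem2p1:
  fixes \<rho> :: "nat \<Rightarrow> nat"
    and \<psi> :: "nat \<Rightarrow> nat \<Rightarrow> real \<Rightarrow> complex"
  assumes "\<And>j. \<rho> j > 0"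
    and "\<And>j m. m \<in> {1..\<rho> j} \<Longrightarrow> \<psi> j m \<in> periodic_L2"
  shows "parseval_wavelet_frame \<rho> \<psi> \<longleftrightarrow>
    (\<forall>n::int. (\<lambda>j. \<Sum>m=1..\<rho> j. 2 ^ j * (cmod (fourier_coeff (\<psi> j m) n))\<^sup>2) sums 1) \<and>
    (\<forall>(k::int) (n::int) (j::nat). odd k \<longrightarrow>
       (\<Sum>q=0..j. 2 ^ q * (\<Sum>m=1..\<rho> q.
          cnj (fourier_coeff (\<psi> q m) n) * fourier_coeff (\<psi> q m) (2 ^ j * k + n))) = 0)"
    (is "_ \<longleftrightarrow> ?diag \<and> ?off")
proof -
  let ?G = "gram \<rho> \<psi>"
  have diag: "?diag \<longleftrightarrow> (\<forall>n. (\<lambda>j. ?G j n n) sums 1)"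
    using sums_of_real_iff[where 'a=complex and c=1] by (simp only: gram_diag of_real_1)
  have off: "?off \<longleftrightarrow> (\<forall>n l. n \<noteq> l \<longrightarrow> (\<lambda>j. ?G j n l) sums 0)"
  proof
    assume off: ?off
    show "\<forall>n l. n \<noteq> l \<longrightarrow> (\<lambda>j. ?G j n l) sums 0"
    proof (intro allI impI)
      fix n l :: int assume "n \<noteq> l"
      then obtain v k where vk: "l - n = 2 ^ v * k" "odd k"
        using two_power_odd_decomposition[of "l - n"] by auto
      then have "l = 2 ^ v * k + n" by simp
      from gram_offdiag_sums[OF this vk(2), of \<rho> \<psi>] show "(\<lambda>j. ?G j n l) sums 0"
        by (simp only: off[rule_format, OF vk(2)])
    qed
  next
    assume *: "\<forall>n l. n \<noteq> l \<longrightarrow> (\<lambda>j. ?G j n l) sums 0"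
    show ?off
    proof (intro allI impI)
      fix k n :: int and j :: nat assume k: "odd k"
      then have "n \<noteq> 2 ^ j * k + n" by auto
      with * have "(\<lambda>i. ?G i n (2 ^ j * k + n)) sums 0" by blast
      from sums_unique2[OF gram_offdiag_sums[OF refl k] this]
      show "(\<Sum>q=0..j. 2 ^ q * (\<Sum>m=1..\<rho> q.
          cnj (fourier_coeff (\<psi> q m) n) * fourier_coeff (\<psi> q m) (2 ^ j * k + n))) = 0" .
    qed
  qed
  have "(\<forall>A c. finite A \<longrightarrow>
      (\<lambda>j. \<Sum>n\<in>A. \<Sum>l\<in>A. c n * cnj (c l) * ?G j n l) sums (\<Sum>n\<in>A. c n * cnj (c n)))
    \<longleftrightarrow> (\<forall>n. (\<lambda>j. ?G j n n) sums 1) \<and> (\<forall>n l. n \<noteq> l \<longrightarrow> (\<lambda>j. ?G j n l) sums 0)"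
  proof
    assume R: "\<forall>A c. finite A \<longrightarrow> (\<lambda>j. \<Sum>n\<in>A. \<Sum>l\<in>A. c n * cnj (c l) * ?G j n l) sums (\<Sum>n\<in>A. c n * cnj (c n))"
    have D: "(\<lambda>j. ?G j n n) sums 1" for n
      using R[rule_format, of "{n}" "\<lambda>_. 1"] by simp
    have "(\<lambda>j. ?G j n l) sums 0" if nl: "n \<noteq> l" for n l
    proof -
      obtain s s' where s: "(\<lambda>j. ?G j n l) sums s" and s': "(\<lambda>j. ?G j l n) sums s'"
        using gram_offdiag_summable[OF nl] gram_offdiag_summable[OF nl[symmetric]]
        unfolding summable_def by blast
      \<comment> \<open>Tests the identity on frequencies \<open>n\<close> and \<open>l\<close> with
        coefficients 1 and \<open>z\<close>. The diagonal entries already account for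
        \<open>1 + z * cnj z\<close>, so the mixed terms must cancel.\<close>
      have "cnj z * s + z * s' = 0" for z
      proof -
        define c where "c = (\<lambda>i. if i = n then 1 else z)"
        have "(\<lambda>j. \<Sum>a\<in>{n, l}. \<Sum>b\<in>{n, l}. c a * cnj (c b) * ?G j a b) sums (\<Sum>a\<in>{n, l}. c a * cnj (c a))"
          by (rule R[rule_format, of "{n, l}" c]) simp
        then have "(\<lambda>j. (?G j n n + cnj z * ?G j n l) + (z * ?G j l n + z * cnj z * ?G j l l)) sums (1 + z * cnj z)"
          using nl by (simp add: c_def)
        moreover have "(\<lambda>j. (?G j n n + cnj z * ?G j n l) + (z * ?G j l n + z * cnj z * ?G j l l))
            sums ((1 + cnj z * s) + (z * s' + z * cnj z * 1))"
          by (intro sums_add sums_mult D s s')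
        ultimately have "1 + z * cnj z = (1 + cnj z * s) + (z * s' + z * cnj z * 1)"
          by (rule sums_unique2)
        then show ?thesis by (simp add: algebra_simps)
      qed
      \<comment> \<open>\<open>z = 1\<close> gives \<open>s + s' = 0\<close>, and
        \<open>z = \<i>\<close> gives \<open>s = s'\<close>.\<close>
      from this[of 1] this[of \<i>] have "s = 0"
        by (simp add: complex_eq_iff)
      with s show ?thesis by simp
    qed
    with D show "(\<forall>n. (\<lambda>j. ?G j n n) sums 1) \<and> (\<forall>n l. n \<noteq> l \<longrightarrow> (\<lambda>j. ?G j n l) sums 0)"
      by blast
  next
    assume DO: "(\<forall>n. (\<lambda>j. ?G j n n) sums 1) \<and> (\<forall>n l. n \<noteq> l \<longrightarrow> (\<lambda>j. ?G j n l) sums 0)"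
    have G: "(\<lambda>j. ?G j n l) sums (if n = l then 1 else 0)" for n l
      using DO by simp
    show "\<forall>A c. finite A \<longrightarrow>
      (\<lambda>j. \<Sum>n\<in>A. \<Sum>l\<in>A. c n * cnj (c l) * ?G j n l) sums (\<Sum>n\<in>A. c n * cnj (c n))"
    proof (intro allI impI)
      fix A :: "int set" and c :: "int \<Rightarrow> complex"
      assume A: "finite A"
      have "(\<lambda>j. \<Sum>n\<in>A. \<Sum>l\<in>A. c n * cnj (c l) * ?G j n l)
          sums (\<Sum>n\<in>A. \<Sum>l\<in>A. c n * cnj (c l) * (if n = l then 1 else 0))"
        by (intro sums_sum sums_mult G)
      also have "(\<Sum>n\<in>A. \<Sum>l\<in>A. c n * cnj (c l) * (if n = l then 1 else 0)) = (\<Sum>n\<in>A. c n * cnj (c n))"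
        using A by (intro sum.cong refl) (simp add: if_distrib cong: if_cong)
      finally show "(\<lambda>j. \<Sum>n\<in>A. \<Sum>l\<in>A. c n * cnj (c l) * ?G j n l) sums (\<Sum>n\<in>A. c n * cnj (c n))" .
    qed
  qed
  then show ?thesis
    unfolding diag off using parseval_wavelet_frame_iff_trig[of \<rho> \<psi>, OF assms(2)] by blast
qed

end
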